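(* Let $\mathcal R=\langle R\mid\nu,\mu\rangle$ be an $(m_r,n_r)$-ring with a polyadic zero $z_R$ and a polyadic identity $e_R$, and let $\mathsf G=\langle G\mid\mu_{\mathsf G}\rangle$ be an $n_g$-ary group with a polyadic identity $\mathsf e_{\mathsf G}$. Let $\ell_n,\ell_g\ge1$, $N=\ell_n(n_r-1)+1=\ell_g(n_g-1)+1$, and let $\boldsymbol\mu:S^N\to S$ be the $N$-ary multiplication of the polyadic group ring. Then $$\mathrm e=e_R\bullet\mathsf e_{\mathsf G}\in S,$$ i.e. the formal sum whose coefficient at $\mathsf e_{\mathsf G}$ is $e_R$ and whose other coefficients are all $z_R$, is a polyadic identity of the polyadic group ring: for every $\mathrm r\in S$, $$\boldsymbol\mu[\mathrm r,\underbrace{\mathrm e,\ldots,\mathrm e}_{N-1}]=\mathrm r,$$ and likewise with $\mathrm r$ in any of the $N$ positions.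
   Context: All arities are integers $\ge 2$. An $n$-ary operation $\mu:X^n\to X$ is totally associative if, for all $x_1,\dots,x_{2n-1}\in X$, the value $\mu[x_1,\dots,x_{i-1},\mu[x_i,\dots,x_{i+n-1}],x_{i+n},\dots,x_{2n-1}]$ does not depend on $i\in\{1,\dots,n\}$; then $\langle X\mid\mu\rangle$ is an $n$-ary semigroup. For $\ell\ge1$, $\mu^{\circ\ell}$ denotes the $\ell$-fold composition of $\mu$ with itself (by associativity the bracketing is irrelevant); it takes exactly $\ell(n-1)+1$ arguments. A polyadic identity of an $n$-ary operation $\mu$ on $X$ is an element $e\in X$ with $\mu[x,e,\dots,e]=x$ for all $x\in X$, and likewise with $x$ in any of the $n$ positions. An $n$-ary group is an $n$-ary semigroup in which (for $n\ge3$) every $x$ has a querelement $\bar x$, i.e. $\mu[\bar x,x,\dots,x]=x$ with $\bar x$ in any of the $n$ positions; for $n=2$ it is an ordinary group. An $(m_r,n_r)$-ring $\langle R\mid\nu,\mu\rangle$ is a set with an $m_r$-ary addition $\nu$ making $R$ a commutative $m_r$-ary group, and an $n_r$-ary multiplication $\mu$ making $R$ an $n_r$-ary semigroup, such that $\mu$ distributes over $\nu$ in each of its $n_r$ arguments. A polyadic identity of the ring is a polyadic identity of $\mu$. A polyadic zero of $\mathcal R$ is an element $z_R\in R$ with $\nu[r,z_R,\dots,z_R]=r$ for all $r$ and with $\mu[r_1,\dots,r_{n_r}]=z_R$ whenever some $r_i=z_R$. Polyadic group ring: $S$ is the set of formal sums $\sum_{g\in G}r_g\bullet g$, i.e. families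 $(r_g)_{g\in G}$ in $R$ with all but finitely many $r_g$ equal to $z_R$. Multiplication is the convolution $$\boldsymbol\mu\Big[\sum_{g} r_g(1)\bullet g,\ldots,\sum_g r_g(N)\bullet g\Big]=\sum_{g_1\in G}\cdots\sum_{g_N\in G}\mu^{\circ\ell_n}\big[r_{g_1}(1),\ldots,r_{g_N}(N)\big]\bullet\mu_{\mathsf G}^{\circ\ell_g}\big[g_1,\ldots,g_N\big],$$ where the coefficients of terms with the same group element are gathered by an iterate of $\nu$ (terms with coefficient $z_R$ being added or dropped so that the number of summands has the form $\ell(m_r-1)+1$). *)

theory Defs
  imports "HOL-Library.Multiset" "HOL-Algebra.Group"
begin

text \<open>
  An \<open>n\<close>-ary operation on a carrier \<open>X\<close> is a function on lists, of which only the values on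
  lists of length \<open>n\<close> over \<open>X\<close> matter.
\<close>

definition nary_op :: "nat \<Rightarrow> 'a set \<Rightarrow> ('a list \<Rightarrow> 'a) \<Rightarrow> bool" where
  "nary_op n X f \<longleftrightarrow> (\<forall>xs. length xs = n \<and> set xs \<subseteq> X \<longrightarrow> f xs \<in> X)"

definition totally_associative :: "nat \<Rightarrow> 'a set \<Rightarrow> ('a list \<Rightarrow> 'a) \<Rightarrow> bool" where
  "totally_associative n X f \<longleftrightarrow>
     (\<forall>xs. length xs = 2 * n - 1 \<and> set xs \<subseteq> X \<longrightarrow>
        (\<forall>i<n. \<forall>j<n. f (take i xs @ [f (take n (drop i xs))] @ drop (i + n) xs) =
                     f (take j xs @ [f (take n (drop j xs))] @ drop (j + n) xs)))"

definition nary_semigroup :: "nat \<Rightarrow> 'a set \<Rightarrow> ('a list \<Rightarrow> 'a) \<Rightarrow> bool" where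
  "nary_semigroup n X f \<longleftrightarrow> 2 \<le> n \<and> nary_op n X f \<and> totally_associative n X f"

text \<open>
  The \<open>l\<close>-fold composition, bracketed from the left: for an \<open>n\<close>-ary semigroup any other
  bracketing gives the same value. It is meant for lists of length \<open>l * (n - 1) + 1\<close>; for
  \<open>l = 0\<close> it is the identity on one argument.
\<close>

fun iterate :: "nat \<Rightarrow> ('a list \<Rightarrow> 'a) \<Rightarrow> nat \<Rightarrow> 'a list \<Rightarrow> 'a" where
  "iterate n f 0 xs = hd xs"
| "iterate n f (Suc l) xs = iterate n f l (f (take n xs) # drop n xs)"

definition polyadic_identity :: "nat \<Rightarrow> 'a set \<Rightarrow> ('a list \<Rightarrow> 'a) \<Rightarrow> 'a \<Rightarrow> bool" where
  "polyadic_identity n X f e \<longleftrightarrow>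
     e \<in> X \<and> (\<forall>x\<in>X. \<forall>i<n. f ((replicate n e)[i := x]) = x)"

definition querelement :: "nat \<Rightarrow> 'a set \<Rightarrow> ('a list \<Rightarrow> 'a) \<Rightarrow> 'a \<Rightarrow> 'a \<Rightarrow> bool" where
  "querelement n X f x y \<longleftrightarrow>
     y \<in> X \<and> (\<forall>i<n. f ((replicate n x)[i := y]) = x)"

text \<open>For \<open>n = 2\<close> querelements do not suffice: any idempotent is its own querelement.\<close>

definition nary_group :: "nat \<Rightarrow> 'a set \<Rightarrow> ('a list \<Rightarrow> 'a) \<Rightarrow> bool" where
  "nary_group n X f \<longleftrightarrow>
     nary_semigroup n X f \<and>
     (if n = 2 then \<exists>e. group \<lparr>carrier = X, mult = (\<lambda>x y. f [x, y]), one = e\<rparr>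
      else \<forall>x\<in>X. \<exists>y. querelement n X f x y)"

definition nary_commutative :: "nat \<Rightarrow> 'a set \<Rightarrow> ('a list \<Rightarrow> 'a) \<Rightarrow> bool" where
  "nary_commutative n X f \<longleftrightarrow>
     (\<forall>xs ys. length xs = n \<and> set xs \<subseteq> X \<and> mset ys = mset xs \<longrightarrow> f ys = f xs)"

definition nary_distributive ::
  "nat \<Rightarrow> nat \<Rightarrow> 'a set \<Rightarrow> ('a list \<Rightarrow> 'a) \<Rightarrow> ('a list \<Rightarrow> 'a) \<Rightarrow> bool" where
  "nary_distributive m n R \<nu> \<mu> \<longleftrightarrow>
     (\<forall>as xs. \<forall>i<n. length as = n \<and> set as \<subseteq> R \<and> length xs = m \<and> set xs \<subseteq> R \<longrightarrow>
        \<mu> (as[i := \<nu> xs]) = \<nu> (map (\<lambda>x. \<mu> (as[i := x])) xs))"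

definition polyadic_ring ::
  "nat \<Rightarrow> nat \<Rightarrow> 'a set \<Rightarrow> ('a list \<Rightarrow> 'a) \<Rightarrow> ('a list \<Rightarrow> 'a) \<Rightarrow> bool" where
  "polyadic_ring m n R \<nu> \<mu> \<longleftrightarrow>
     nary_group m R \<nu> \<and> nary_commutative m R \<nu> \<and> nary_semigroup n R \<mu> \<and>
     nary_distributive m n R \<nu> \<mu>"

definition polyadic_zero ::
  "nat \<Rightarrow> nat \<Rightarrow> 'a set \<Rightarrow> ('a list \<Rightarrow> 'a) \<Rightarrow> ('a list \<Rightarrow> 'a) \<Rightarrow> 'a \<Rightarrow> bool" where
  "polyadic_zero m n R \<nu> \<mu> z \<longleftrightarrow>
     z \<in> R \<and> (\<forall>r\<in>R. \<nu> (r # replicate (m - 1) z) = r) \<and>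
     (\<forall>rs. length rs = n \<and> set rs \<subseteq> R \<and> z \<in> set rs \<longrightarrow> \<mu> rs = z)"

text \<open>
  The sum over \<open>a \<in> A\<close> of a family \<open>c\<close> with only finitely many members different from \<open>z\<close>: the
  members different from \<open>z\<close>, listed in any order and padded with any number of copies of \<open>z\<close>
  that makes the total number of summands admissible, are added by an iterate of \<open>\<nu>\<close>.
\<close>

definition polyadic_sum ::
  "nat \<Rightarrow> ('a list \<Rightarrow> 'a) \<Rightarrow> 'a \<Rightarrow> 'b set \<Rightarrow> ('b \<Rightarrow> 'a) \<Rightarrow> 'a" where
  "polyadic_sum m \<nu> z A c =
     (THE s. \<exists>as k l. distinct as \<and> set as = {a \<in> A. c a \<noteq> z} \<and>
        length as + k = l * (m - 1) + 1 \<and>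
        s = iterate m \<nu> l (map c as @ replicate k z))"

definition group_ring_carrier :: "'r set \<Rightarrow> 'r \<Rightarrow> 'g set \<Rightarrow> ('g \<Rightarrow> 'r) set" where
  "group_ring_carrier R z G = {r \<in> G \<rightarrow>\<^sub>E R. finite {g \<in> G. r g \<noteq> z}}"

text \<open>
  The coefficient at \<open>h\<close> of the convolution collects all tuples \<open>gs\<close> over \<open>G\<close>, of length the
  number of factors, whose product is \<open>h\<close>.
\<close>

definition group_ring_mult ::
  "nat \<Rightarrow> nat \<Rightarrow> ('r list \<Rightarrow> 'r) \<Rightarrow> ('r list \<Rightarrow> 'r) \<Rightarrow> 'r \<Rightarrow>
   nat \<Rightarrow> 'g set \<Rightarrow> ('g list \<Rightarrow> 'g) \<Rightarrow> nat \<Rightarrow> nat \<Rightarrow> ('g \<Rightarrow> 'r) list \<Rightarrow> 'g \<Rightarrow> 'r" where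
  "group_ring_mult m n \<nu> \<mu> z ng G \<mu>G ln lg rs =
     (\<lambda>h\<in>G. polyadic_sum m \<nu> z
        {gs. length gs = length rs \<and> set gs \<subseteq> G \<and> iterate ng \<mu>G lg gs = h}
        (\<lambda>gs. iterate n \<mu> ln (map2 (\<lambda>r g. r g) rs gs)))"

text \<open>The formal sum with the single term \<open>a \<bullet> g0\<close>.\<close>

definition group_ring_monom :: "'r \<Rightarrow> 'g set \<Rightarrow> 'r \<Rightarrow> 'g \<Rightarrow> 'g \<Rightarrow> 'r" where
  "group_ring_monom z G a g0 = (\<lambda>g\<in>G. if g = g0 then a else z)"

end

theory Submission
  imports Defs
begin

text \<open>
  Write \<open>e = eR \<bullet> eG\<close> and let \<open>r\<close> stand in position \<open>i\<close> among \<open>N - 1\<close> copies of \<open>e\<close>. The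
  coefficient of the convolution at \<open>h\<close> is a sum over all tuples \<open>gs\<close> with product \<open>h\<close>. A tuple
  with an entry other than \<open>eG\<close> outside position \<open>i\<close> picks up a factor \<open>zR\<close>, and the zero is
  absorbing for every iterate of \<open>\<mu>\<close> (lemma \<open>iterate_absorbing\<close>), so its term vanishes.
  The remaining tuples consist of one element \<open>g\<close> and otherwise of \<open>eG\<close>; their product is \<open>g\<close>,
  because an identity stays an identity for every iterate (lemma \<open>iterate_identity\<close>), whence
  \<open>g = h\<close>. Hence a single tuple can contribute, and its coefficient is \<open>r h\<close>, by
  the same lemma applied to \<open>\<mu>\<close>. Finally, adding any admissible number of zeros to one element
  does not change it, so that the sum is well defined and equal to \<open>r h\<close>
  (lemma \<open>polyadic_sum_single\<close>). The value \<open>r h\<close> may itself be \<open>zR\<close>, and then the list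
  of summands that differ from \<open>zR\<close> is empty.
\<close>

text \<open>
  The first application of \<open>f\<close> either meets \<open>x\<close> and returns it as the new head, or it sees only
  copies of \<open>e\<close> and returns \<open>e\<close>, which moves \<open>x\<close> down by \<open>n - 1\<close> positions.
\<close>

lemma iterate_identity:
  assumes id: "polyadic_identity n X f e" and n: "1 \<le> n" and x: "x \<in> X"
    and i: "i < l * (n - 1) + 1"
  shows "iterate n f l ((replicate (l * (n - 1) + 1) e)[i := x]) = x"
  using i
proof (induction l arbitrary: i)
  case 0
  then show ?case by simp
next
  case (Suc l)
  let ?k = "l * (n - 1)"
  let ?xs = "(replicate (Suc l * (n - 1) + 1) e)[i := x]"
  have len: "Suc l * (n - 1) + 1 = n + ?k"
    using n by simp
  have f_at: "f ((replicate n e)[j := y]) = y" if "j < n" "y \<in> X" for j y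
    using id that unfolding polyadic_identity_def by blast
  show ?case
  proof (cases "i < n")
    case True
    have "take n ?xs = (replicate n e)[i := x]" "drop n ?xs = replicate ?k e"
      unfolding len using True by (simp_all add: take_update_swap drop_update_cancel)
    then have "iterate n f (Suc l) ?xs = iterate n f l ((replicate (?k + 1) e)[0 := x])"
      using f_at[OF True x] by simp
    also have "\<dots> = x"
      by (rule Suc.IH) simp
    finally show ?thesis .
  next
    case False
    have "f (replicate n e) = f ((replicate n e)[0 := e])"
      using list_update_id[of "replicate n e" 0] n by simp
    also have "\<dots> = e"
      using f_at[of 0 e] n id unfolding polyadic_identity_def by simp
    finally have fe: "f (replicate n e) = e" .
    have "take n ?xs = replicate n e" "drop n ?xs = (replicate ?k e)[i - n := x]"
      unfolding len using False by (simp_all add: drop_update_swap)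
    then have "iterate n f (Suc l) ?xs = iterate n f l ((replicate (?k + 1) e)[i - n + 1 := x])"
      using fe by simp
    also have "\<dots> = x"
    proof (rule Suc.IH)
      show "i - n + 1 < ?k + 1"
        using Suc.prems False unfolding len by linarith
    qed
    finally show ?thesis .
  qed
qed

lemma iterate_absorbing:
  assumes op: "nary_op n X f" and n: "1 \<le> n"
    and absorb: "\<And>ys. length ys = n \<Longrightarrow> set ys \<subseteq> X \<Longrightarrow> z \<in> set ys \<Longrightarrow> f ys = z"
    and "length xs = l * (n - 1) + 1" "set xs \<subseteq> X" "z \<in> set xs"
  shows "iterate n f l xs = z"
  using assms(4-)
proof (induction l arbitrary: xs)
  case 0
  then show ?case by (cases xs) auto
next
  case (Suc l)
  have len: "length (take n xs) = n" "length (drop n xs) = l * (n - 1)"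
    using Suc.prems(1) n by simp_all
  have sub: "set (take n xs) \<subseteq> X" "set (drop n xs) \<subseteq> X"
    using Suc.prems(2) set_take_subset set_drop_subset by fast+
  have "f (take n xs) \<in> X"
    using op len sub unfolding nary_op_def by blast
  moreover have "z \<in> set (take n xs) \<or> z \<in> set (drop n xs)"
    using Suc.prems(3) by (metis Un_iff append_take_drop_id set_append)
  then have "z \<in> set (f (take n xs) # drop n xs)"
    using absorb len sub by auto
  ultimately show ?case
    using len sub by (simp add: Suc.IH)
qed

lemma iterate_add_neutral:
  assumes "f (x # replicate (n - 1) z) = x" and "1 \<le> n"
  shows "iterate n f l (x # replicate (l * (n - 1)) z) = x"
proof (induction l)
  case 0
  then show ?case by simp
next
  case (Suc l)
  let ?xs = "x # replicate (Suc l * (n - 1)) z"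
  have "take n ?xs = x # replicate (n - 1) z" "drop n ?xs = replicate (l * (n - 1)) z"
    using assms(2) by (cases n; simp)+
  then show ?case using assms(1) Suc.IH by simp
qed

text \<open>
  Every admissible list of summands consists of \<open>c a\<close> followed by copies of \<open>z\<close>; for \<open>c a = z\<close>
  the leading summand is one of the padding zeros.
\<close>

lemma polyadic_sum_single:
  assumes neutral: "\<nu> (c a # replicate (m - 1) z) = c a" and m: "1 \<le> m"
    and a: "a \<in> A" and supp: "\<And>b. b \<in> A \<Longrightarrow> c b \<noteq> z \<Longrightarrow> b = a"
  shows "polyadic_sum m \<nu> z A c = c a"
  unfolding polyadic_sum_def
proof (rule the_equality)
  let ?B = "{b \<in> A. c b \<noteq> z}"
  have B: "?B = (if c a = z then {} else {a})"
  proof (cases "c a = z")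
    case True
    then have "?B = {}" using supp by blast
    then show ?thesis using True by simp
  next
    case False
    then have "?B = {a}" using a supp by blast
    then show ?thesis using False by simp
  qed
  show "\<exists>as k l. distinct as \<and> set as = ?B \<and> length as + k = l * (m - 1) + 1 \<and>
          c a = iterate m \<nu> l (map c as @ replicate k z)"
  proof (cases "c a = z")
    case True
    have "distinct [] \<and> set [] = ?B \<and> length [] + 1 = 0 * (m - 1) + (1::nat) \<and>
        c a = iterate m \<nu> 0 (map c [] @ replicate 1 z)"
      unfolding B using True by simp
    then show ?thesis by blast
  next
    case False
    have "distinct [a] \<and> set [a] = ?B \<and> length [a] + 0 = 0 * (m - 1) + (1::nat) \<and>
        c a = iterate m \<nu> 0 (map c [a] @ replicate 0 z)"
      unfolding B using False by simp
    then show ?thesis by blast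
  qed
  fix s
  assume "\<exists>as k l. distinct as \<and> set as = ?B \<and>
            length as + k = l * (m - 1) + 1 \<and> s = iterate m \<nu> l (map c as @ replicate k z)"
  then obtain as k l where as: "distinct as" "set as = ?B"
    and k: "length as + k = l * (m - 1) + 1"
    and s: "s = iterate m \<nu> l (map c as @ replicate k z)"
    by blast
  have "map c as @ replicate k z = c a # replicate (l * (m - 1)) z"
  proof (cases "c a = z")
    case True
    then have "set as = {}"
      unfolding as(2) B by simp
    then show ?thesis using True k by simp
  next
    case False
    then have set_as: "set as = {a}"
      unfolding as(2) B by simp
    then have "length as = 1"
      using distinct_card[OF as(1)] by simp
    with set_as have "as = [a]"
      by (cases as) auto
    then show ?thesis using k by simp
  qed
  then show "s = c a"
    using s iterate_add_neutral[of \<nu> "c a" m z l] neutral m by simp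
qed

theorem mainTheorem7:
  fixes R :: "'r set" and G :: "'g set"
    and \<nu> \<mu> :: "'r list \<Rightarrow> 'r" and \<mu>G :: "'g list \<Rightarrow> 'g"
    and zR eR :: 'r and eG :: 'g
    and mr nr ng ln lg N :: nat
  assumes "polyadic_ring mr nr R \<nu> \<mu>"
    and "polyadic_zero mr nr R \<nu> \<mu> zR"
    and "polyadic_identity nr R \<mu> eR"
    and "nary_group ng G \<mu>G"
    and "polyadic_identity ng G \<mu>G eG"
    and "1 \<le> ln" and "1 \<le> lg"
    and "N = ln * (nr - 1) + 1" and "N = lg * (ng - 1) + 1"
  shows "polyadic_identity N (group_ring_carrier R zR G)
           (group_ring_mult mr nr \<nu> \<mu> zR ng G \<mu>G ln lg)
           (group_ring_monom zR G eR eG)"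
proof -
  let ?e = "group_ring_monom zR G eR eG"
  have op: "nary_op nr R \<mu>" and nr: "1 \<le> nr" and mr: "1 \<le> mr" and ng: "1 \<le> ng"
    using assms(1,4) unfolding polyadic_ring_def nary_group_def nary_semigroup_def by auto
  have z: "zR \<in> R" and add_z: "\<And>x. x \<in> R \<Longrightarrow> \<nu> (x # replicate (mr - 1) zR) = x"
    and absorb: "\<And>xs. length xs = nr \<Longrightarrow> set xs \<subseteq> R \<Longrightarrow> zR \<in> set xs \<Longrightarrow> \<mu> xs = zR"
    using assms(2) unfolding polyadic_zero_def by blast+
  have eR: "eR \<in> R" and eG: "eG \<in> G"
    using assms(3,5) unfolding polyadic_identity_def by blast+
  have "finite {g \<in> G. ?e g \<noteq> zR}"
    by (rule finite_subset[of _ "{eG}"]) (auto simp: group_ring_monom_def split: if_splits)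
  then have e_in: "?e \<in> group_ring_carrier R zR G"
    unfolding group_ring_carrier_def using eR z by (auto simp: group_ring_monom_def)
  have "group_ring_mult mr nr \<nu> \<mu> zR ng G \<mu>G ln lg ((replicate N ?e)[i := r]) = r"
    (is "?prod = r")
    if r_in: "r \<in> group_ring_carrier R zR G" and i: "i < N" for r i
  proof
    fix h
    let ?rs = "(replicate N ?e)[i := r]"
    let ?c = "\<lambda>gs. iterate nr \<mu> ln (map2 (\<lambda>r g. r g) ?rs gs)"
    let ?A = "{gs. length gs = length ?rs \<and> set gs \<subseteq> G \<and> iterate ng \<mu>G lg gs = h}"
    let ?hs = "(replicate N eG)[i := h]"
    have r: "r \<in> G \<rightarrow>\<^sub>E R"
      using r_in unfolding group_ring_carrier_def by blast
    show "?prod h = r h"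
    proof (cases "h \<in> G")
      case False
      then show ?thesis using r by (auto simp: group_ring_mult_def)
    next
      case True
      then have rh: "r h \<in> R" using r by auto
      have product: "iterate ng \<mu>G lg ((replicate N eG)[i := g]) = g" if "g \<in> G" for g
        using iterate_identity[OF assms(5) ng that] i assms(9) by simp
      have "set ?hs \<subseteq> G"
        using set_update_subset_insert[of "replicate N eG" i h] True eG by auto
      then have hs_in: "?hs \<in> ?A"
        using product[OF True] by simp
      have "map2 (\<lambda>r g. r g) ?rs ?hs = (replicate N eR)[i := r h]"
        using eG i by (intro nth_equalityI) (auto simp: nth_list_update group_ring_monom_def)
      then have c_hs: "?c ?hs = r h"
        using iterate_identity[OF assms(3) nr rh] i assms(8) by simp
      have unique: "gs = ?hs" if gs: "gs \<in> ?A" and nz: "?c gs \<noteq> zR" for gs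
      proof -
        have len: "length gs = N" and gsG: "\<And>j. j < N \<Longrightarrow> gs ! j \<in> G"
          using gs by (auto simp: subset_iff)
        have coeffs: "set (map2 (\<lambda>r g. r g) ?rs gs) \<subseteq> R"
        proof
          fix y assume "y \<in> set (map2 (\<lambda>r g. r g) ?rs gs)"
          then obtain j where j: "j < N" and y: "y = (?rs ! j) (gs ! j)"
            using len by (auto simp: in_set_conv_nth)
          show "y \<in> R"
          proof (cases "j = i")
            case True
            then show ?thesis using y i r gsG[OF j] by auto
          next
            case False
            then show ?thesis using y j gsG[OF j] eR z by (simp add: group_ring_monom_def)
          qed
        qed
        have "gs ! j = eG" if j: "j < N" "j \<noteq> i" for j
        proof (rule ccontr)
          assume "gs ! j \<noteq> eG"
          then have "map2 (\<lambda>r g. r g) ?rs gs ! j = zR"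
            using j len gsG by (simp add: group_ring_monom_def)
          then have "zR \<in> set (map2 (\<lambda>r g. r g) ?rs gs)"
            using j len nth_mem[of j "map2 (\<lambda>r g. r g) ?rs gs"] by simp
          moreover have "length (map2 (\<lambda>r g. r g) ?rs gs) = ln * (nr - 1) + 1"
            unfolding assms(8)[symmetric] using len by simp
          ultimately have "?c gs = zR"
            using iterate_absorbing[OF op nr absorb] coeffs by blast
          then show False using nz by contradiction
        qed
        then have gs_eq: "gs = (replicate N eG)[i := gs ! i]"
          using len i by (intro nth_equalityI) (auto simp: nth_list_update)
        have "gs ! i = iterate ng \<mu>G lg gs"
          using product[OF gsG[OF i]] gs_eq by simp
        also have "\<dots> = h" using gs by simp
        finally show ?thesis using gs_eq by simp
      qed
      have "?prod h = polyadic_sum mr \<nu> zR ?A ?c"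
        using True by (simp add: group_ring_mult_def)
      also have "\<dots> = ?c ?hs"
      proof (rule polyadic_sum_single)
        show "\<nu> (?c ?hs # replicate (mr - 1) zR) = ?c ?hs"
          unfolding c_hs by (rule add_z[OF rh])
      qed (use mr hs_in unique in auto)
      finally show ?thesis using c_hs by simp
    qed
  qed
  then show ?thesis
    unfolding polyadic_identity_def using e_in by blast
qed

end
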